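(* Intuitionistic implication is not uniformly definable in propositional dependence logic $\mathbf{PD}$. That is, there is no context $\phi[r_1,r_2]$ for $\mathbf{PD}$ such that $\phi[\theta_1,\theta_2]\equiv \theta_1\to\theta_2$ for all $\mathbf{PD}$-formulas $\theta_1,\theta_2$.
   Context: Fix a nonempty set $\mathrm{Prop}$ of propositional variables. Formulas of $\mathbf{PT}_0$ (propositional downward closed team logic) are given by $$\phi::= p\mid \neg p\mid \bot\mid {=}(p_1,\dots,p_k,q)\mid (\phi\wedge\phi)\mid(\phi\otimes\phi)\mid(\phi\vee\phi)\mid(\phi\to\phi),$$ with $p,p_i,q\in\mathrm{Prop}$. The formulas $p,\neg p,\bot$ and ${=}(p_1,\dots,p_k,q)$ (with $k\ge 0$) are atoms; in particular negation is not a connective. $\mathbf{PD}$-formulas are the $\mathbf{PT}_0$-formulas built from all these atoms using only $\wedge$ and $\otimes$. The connectives $\vee$ and $\to$ are called intuitionistic disjunction and intuitionistic implication. A team is a set $X$ of valuations $v:\mathrm{Prop}\to\{0,1\}$. Satisfaction $X\models\phi$: - $X\models p$ iff $v(p)=1$ for all $v\in X$; $X\models\neg p$ iff $v(p)=0$ for all $v\in X$; $X\models\bot$ iff $X=\emptyset$; - $X\models{=}(p_1,\dots,p_k,q)$ iff for all $v,v'\in X$, if $v(p_i)=v'(p_i)$ for all $i\le k$, then $v(q)=v'(q)$; - $X\models\phi\wedge\psi$ iff $X\models\phi$ and $X\models\psi$; - $X\models\phi\otimes\psi$ iff there are $Y,Z\subseteq X$ with $X=Y\cup Z$, $Y\models\phi$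 and $Z\models\psi$; - $X\models\phi\vee\psi$ iff $X\models\phi$ or $X\models\psi$; - $X\models\phi\to\psi$ iff for every team $Y\subseteq X$, $Y\models\phi$ implies $Y\models\psi$. $\phi\equiv\psi$ means that $X\models\phi\iff X\models\psi$ for all teams $X$. A context $\phi[r_1,\dots,r_m]$ for $\mathbf{PD}$ is a formula built using $\wedge,\otimes$ from the atoms of $\mathbf{PD}$ together with distinguished placeholder atoms $r_1,\dots,r_m$ (these are not allowed to occur negated or inside dependence atoms). For $\mathbf{PD}$-formulas $\theta_1,\dots,\theta_m$, $\phi[\theta_1,\dots,\theta_m]$ is the $\mathbf{PD}$-formula obtained by replacing every occurrence of each $r_i$ by $\theta_i$. *)

theory Defs
  imports Main
begin

text \<open>
  The nonempty set of propositional variables is the type variable \<open>'p\<close>, of arbitrary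
  (finite or infinite) cardinality. Truth values 1 and 0 are \<^const>\<open>True\<close> and \<^const>\<open>False\<close>.
\<close>

datatype 'p atom =
    Pos 'p
  | Neg 'p
  | Bot
  | Dep "'p list" 'p  \<comment> \<open>\<open>Dep [p\<^sub>1, \<dots>, p\<^sub>k] q\<close> is \<open>=(p\<^sub>1, \<dots>, p\<^sub>k, q)\<close>; the list may be empty\<close>

datatype 'p form =
    Atom "'p atom"
  | Conj "'p form" "'p form"    (infixr "\<^bold>\<and>" 75)
  | Tensor "'p form" "'p form"  (infixr "\<^bold>\<otimes>" 70)
  | IDisj "'p form" "'p form"   (infixr "\<^bold>\<or>" 65)
  | Imp "'p form" "'p form"     (infixr "\<^bold>\<rightarrow>" 60)

type_synonym 'p team = "('p \<Rightarrow> bool) set"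

primrec sat_atom :: "'p team \<Rightarrow> 'p atom \<Rightarrow> bool" where
  "sat_atom X (Pos p) \<longleftrightarrow> (\<forall>v\<in>X. v p)"
| "sat_atom X (Neg p) \<longleftrightarrow> (\<forall>v\<in>X. \<not> v p)"
| "sat_atom X Bot \<longleftrightarrow> X = {}"
| "sat_atom X (Dep ps q) \<longleftrightarrow>
     (\<forall>v\<in>X. \<forall>v'\<in>X. (\<forall>p\<in>set ps. v p = v' p) \<longrightarrow> v q = v' q)"

primrec sat :: "'p team \<Rightarrow> 'p form \<Rightarrow> bool"  (infix "\<Turnstile>" 50) where
  "X \<Turnstile> Atom a \<longleftrightarrow> sat_atom X a"
| "X \<Turnstile> \<phi> \<^bold>\<and> \<psi> \<longleftrightarrow> X \<Turnstile> \<phi> \<and> X \<Turnstile> \<psi>"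
| "X \<Turnstile> \<phi> \<^bold>\<otimes> \<psi> \<longleftrightarrow> (\<exists>Y Z. Y \<subseteq> X \<and> Z \<subseteq> X \<and> X = Y \<union> Z \<and> Y \<Turnstile> \<phi> \<and> Z \<Turnstile> \<psi>)"
| "X \<Turnstile> \<phi> \<^bold>\<or> \<psi> \<longleftrightarrow> X \<Turnstile> \<phi> \<or> X \<Turnstile> \<psi>"
| "X \<Turnstile> \<phi> \<^bold>\<rightarrow> \<psi> \<longleftrightarrow> (\<forall>Y. Y \<subseteq> X \<longrightarrow> Y \<Turnstile> \<phi> \<longrightarrow> Y \<Turnstile> \<psi>)"

definition form_equiv :: "'p form \<Rightarrow> 'p form \<Rightarrow> bool"  (infix "\<equiv>\<^sub>t" 50) where
  "\<phi> \<equiv>\<^sub>t \<psi> \<longleftrightarrow> (\<forall>X. X \<Turnstile> \<phi> \<longleftrightarrow> X \<Turnstile> \<psi>)"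

primrec is_PD :: "'p form \<Rightarrow> bool" where
  "is_PD (Atom a) \<longleftrightarrow> True"
| "is_PD (\<phi> \<^bold>\<and> \<psi>) \<longleftrightarrow> is_PD \<phi> \<and> is_PD \<psi>"
| "is_PD (\<phi> \<^bold>\<otimes> \<psi>) \<longleftrightarrow> is_PD \<phi> \<and> is_PD \<psi>"
| "is_PD (\<phi> \<^bold>\<or> \<psi>) \<longleftrightarrow> False"
| "is_PD (\<phi> \<^bold>\<rightarrow> \<psi>) \<longleftrightarrow> False"

text \<open>
  Contexts for PD. The placeholders \<open>r\<^sub>1, r\<^sub>2, \<dots>\<close> are \<open>Hole 0, Hole 1, \<dots>\<close>; being separate from
  the variables in \<open>'p\<close>, they can occur neither negated nor inside a dependence atom.
\<close>

datatype 'p pd_ctx =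
    CAtom "'p atom"
  | Hole nat
  | CConj "'p pd_ctx" "'p pd_ctx"
  | CTensor "'p pd_ctx" "'p pd_ctx"

primrec holes :: "'p pd_ctx \<Rightarrow> nat set" where
  "holes (CAtom a) = {}"
| "holes (Hole i) = {i}"
| "holes (CConj c d) = holes c \<union> holes d"
| "holes (CTensor c d) = holes c \<union> holes d"

text \<open>A context \<open>\<phi>[r\<^sub>1, \<dots>, r\<^sub>m]\<close>; not every placeholder has to occur.\<close>

definition is_ctx :: "nat \<Rightarrow> 'p pd_ctx \<Rightarrow> bool" where
  "is_ctx m c \<longleftrightarrow> holes c \<subseteq> {..<m}"

text \<open>
  \<open>fill c [\<theta>\<^sub>1, \<dots>, \<theta>\<^sub>m]\<close> is \<open>\<phi>[\<theta>\<^sub>1, \<dots>, \<theta>\<^sub>m]\<close>; it is meaningful only if \<open>is_ctx m c\<close>.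
\<close>

primrec fill :: "'p pd_ctx \<Rightarrow> 'p form list \<Rightarrow> 'p form" where
  "fill (CAtom a) \<theta>s = Atom a"
| "fill (Hole i) \<theta>s = \<theta>s ! i"
| "fill (CConj c d) \<theta>s = fill c \<theta>s \<^bold>\<and> fill d \<theta>s"
| "fill (CTensor c d) \<theta>s = fill c \<theta>s \<^bold>\<otimes> fill d \<theta>s"

lemma is_PD_fill:
  assumes "is_ctx (length \<theta>s) c" and "\<forall>\<theta>\<in>set \<theta>s. is_PD \<theta>"
  shows "is_PD (fill c \<theta>s)"
  using assms by (induction c) (auto simp: is_ctx_def)

end

theory Submission
  imports Defs
begin

text \<open>
  Contexts for PD are monotone in their placeholders, because \<open>\<^bold>\<and>\<close> and \<open>\<^bold>\<otimes>\<close> are monotone in both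
  arguments and placeholders do not occur negated. Intuitionistic implication is not monotone in its
  antecedent: strengthening the antecedent makes the implication easier to satisfy. The clash
  already shows when \<open>\<bottom>\<close> in the antecedent is weakened to a valid formula. Every team satisfies
  \<open>\<bottom> \<^bold>\<rightarrow> \<bottom>\<close>, whereas only the empty team satisfies \<open>\<top> \<^bold>\<rightarrow> \<bottom>\<close>; a monotone context equivalent to
  implication would carry every team from the former to the latter.
\<close>

text \<open>
  The hypothesis is entailment on all teams, not only on \<open>X\<close>, because a tensor passes from \<open>X\<close> to
  subteams.
\<close>

lemma fill_mono:
  assumes "\<And>i Y. i \<in> holes c \<Longrightarrow> Y \<Turnstile> \<theta>s ! i \<Longrightarrow> Y \<Turnstile> \<theta>s' ! i"
    and "X \<Turnstile> fill c \<theta>s"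
  shows "X \<Turnstile> fill c \<theta>s'"
  using assms
proof (induction c arbitrary: X)
  case (CTensor c d)
  from CTensor.prems(2) obtain Y Z
    where "X = Y \<union> Z" "Y \<Turnstile> fill c \<theta>s" "Z \<Turnstile> fill d \<theta>s"
    by auto
  moreover from this have "Y \<Turnstile> fill c \<theta>s'" "Z \<Turnstile> fill d \<theta>s'"
    using CTensor.IH CTensor.prems(1) by simp_all
  ultimately show ?case
    by auto
qed simp_all

theorem theorem5p1:
  shows "\<not> (\<exists>c :: 'p pd_ctx. is_ctx 2 c \<and>
           (\<forall>\<theta>1 \<theta>2. is_PD \<theta>1 \<longrightarrow> is_PD \<theta>2 \<longrightarrow> fill c [\<theta>1, \<theta>2] \<equiv>\<^sub>t (\<theta>1 \<^bold>\<rightarrow> \<theta>2)))"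
proof
  assume "\<exists>c :: 'p pd_ctx. is_ctx 2 c \<and>
    (\<forall>\<theta>1 \<theta>2. is_PD \<theta>1 \<longrightarrow> is_PD \<theta>2 \<longrightarrow> fill c [\<theta>1, \<theta>2] \<equiv>\<^sub>t (\<theta>1 \<^bold>\<rightarrow> \<theta>2))"
  then obtain c :: "'p pd_ctx" where ctx: "is_ctx 2 c"
    and def: "\<And>\<theta>1 \<theta>2 X. is_PD \<theta>1 \<Longrightarrow> is_PD \<theta>2 \<Longrightarrow> X \<Turnstile> fill c [\<theta>1, \<theta>2] \<longleftrightarrow> X \<Turnstile> \<theta>1 \<^bold>\<rightarrow> \<theta>2"
    unfolding form_equiv_def by blast
  define bot :: "'p form" where "bot = Atom Bot"
  \<comment> \<open>PD has no atom for truth, but \<open>=(p, p)\<close> holds in every team, whatever the variable \<open>p\<close>.\<close>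
  define top :: "'p form" where "top = Atom (Dep [undefined] undefined)"
  have PD: "is_PD bot" "is_PD top"
    by (simp_all add: bot_def top_def)
  have top: "Y \<Turnstile> top" for Y
    by (simp add: top_def)
  have "UNIV \<Turnstile> fill c [bot, bot]"
    by (simp add: def PD)
  moreover have "Y \<Turnstile> [top, bot] ! i" if "i \<in> holes c" "Y \<Turnstile> [bot, bot] ! i" for i Y
  proof -
    from that(1) ctx have "i = 0 \<or> i = 1"
      by (auto simp: is_ctx_def)
    with that(2) top show ?thesis
      by auto
  qed
  ultimately have "UNIV \<Turnstile> fill c [top, bot]"
    by (rule fill_mono[rotated])
  then have "UNIV \<Turnstile> top \<^bold>\<rightarrow> bot"
    by (simp only: def PD)
  then show False
    using top by (auto simp: bot_def)
qed

end
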